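(* Let $\mathcal{W}=\{\mathbb{R}^d; f_1,\dots,f_N; p_1,\dots,p_N\}$ be a weighted IFS, $N\ge 2$, with $p_i>0$, $\sum_i p_i=1$, such that each $f_i$ satisfies $$s_i\|x-y\|\le \|f_i(x)-f_i(y)\|\le c_i\|x-y\|\quad\text{for all }x,y\in\mathbb{R}^d,$$ where $0<s_i\le c_i<1$. Let $\mu$ be the invariant Borel probability measure of $\mathcal{W}$, and assume that $\mathcal{W}$ satisfies the strong open set condition. Then for every $r\in(0,\infty)$, $$k_r\le \underline{D}_r(\mu)\le \overline{D}_r(\mu)\le l_r,$$ where $k_r,l_r\in(0,\infty)$ are the unique numbers with $\sum_{i=1}^N (p_i s_i^r)^{\frac{k_r}{r+k_r}}=1$ and $\sum_{i=1}^N (p_i c_i^r)^{\frac{l_r}{r+l_r}}=1$.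
   Context: $\|\cdot\|$ is the Euclidean norm. The invariant measure of a weighted IFS $\{\mathbb{R}^d;f_1,\dots,f_N;p_1,\dots,p_N\}$ (contractions $f_i$, probability vector $(p_i)$ with all $p_i>0$) is the unique Borel probability measure $\mu$ with $\mu=\sum_{i=1}^N p_i\,\mu\circ f_i^{-1}$; it is supported on the attractor $A$, the unique nonempty compact set with $A=\bigcup_i f_i(A)$. The IFS satisfies the strong open set condition (SOSC) if there is a nonempty open set $U$ with $f_i(U)\subset U$ for all $i$, $f_i(U)\cap f_j(U)=\emptyset$ for $i\ne j$, and $U\cap A\neq\emptyset$. For a Borel probability measure $\mu$ on $\mathbb{R}^d$, $r\in(0,\infty)$, $n\in\mathbb{N}$: $V_{n,r}(\mu)=\inf\{\int \operatorname{dist}(x,B)^r\,d\mu(x): B\subset\mathbb{R}^d,\ \operatorname{card}(B)\le n\}$, $e_{n,r}(\mu)=V_{n,r}(\mu)^{1/r}$, and the lower/upper quantization dimensions of order $r$ are $\underline{D}_r(\mu)=\liminf_{n\to\infty}\frac{\log n}{-\log e_{n,r}(\mu)}$, $\overline{D}_r(\mu)=\limsup_{n\to\infty}\frac{\log n}{-\log e_{n,r}(\mu)}$. *)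

theory Defs
  imports "HOL-Probability.Probability"
begin

definition quant_V :: "'a::euclidean_space measure \<Rightarrow> real \<Rightarrow> nat \<Rightarrow> ennreal" where
  "quant_V M r n = Inf {(\<integral>\<^sup>+ x. ennreal (infdist x B powr r) \<partial>M) | B.
      finite B \<and> B \<noteq> {} \<and> card B \<le> n}"

definition quant_e :: "'a::euclidean_space measure \<Rightarrow> real \<Rightarrow> nat \<Rightarrow> real" where
  "quant_e M r n = enn2real (quant_V M r n) powr (1 / r)"

definition lower_qdim :: "'a::euclidean_space measure \<Rightarrow> real \<Rightarrow> ereal" where
  "lower_qdim M r = liminf (\<lambda>n. ereal (ln (real n) / - ln (quant_e M r n)))"

definition upper_qdim :: "'a::euclidean_space measure \<Rightarrow> real \<Rightarrow> ereal" where
  "upper_qdim M r = limsup (\<lambda>n. ereal (ln (real n) / - ln (quant_e M r n)))"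

definition SOSC :: "nat \<Rightarrow> (nat \<Rightarrow> 'a::real_normed_vector \<Rightarrow> 'a) \<Rightarrow> 'a set \<Rightarrow> bool" where
  "SOSC N f K \<longleftrightarrow> (\<exists>U. open U \<and> U \<noteq> {} \<and> (\<forall>i<N. f i ` U \<subseteq> U) \<and>
      (\<forall>i<N. \<forall>j<N. i \<noteq> j \<longrightarrow> f i ` U \<inter> f j ` U = {}) \<and> U \<inter> K \<noteq> {})"

end

(* Upper bound: if B_i is a good quantizer with t_i x centres, where t_i = (p_i c_i^r)^(l/(r+l)),
   then the union of the f_i(B_i) is one with x centres, since the t_i sum to 1; induction on the
   scale of x gives V_n = O(n^(-r/l)).

   Lower bound: by the strong open set condition some word v maps K into U.  For each m the maps
   f_w f_v with |w| = m then have disjoint images of K, and M dominates the corresponding weighted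
   sum of its image measures.  For k' < k and m large, the powers (p_wv s_wv^r)^(k'/(r+k')) sum to at
   least 1.  The distance capped at half the separation gives a functional that reproduces itself
   under these maps: each centre is near the image of K under at most one of them.  Induction on the
   number of centres, via convexity of z^(-r/k'), bounds V_n below by a multiple of n^(-r/k'). *)

theory Submission
  imports Defs "HOL-Real_Asymp.Real_Asymp"
begin

section \<open>Dimension bounds from error bounds\<close>

text \<open>Taking logarithms turns the power bound into \<open>- ln (quant_e M r n)\<close> being
  at least \<open>ln n / l - ln C\<close>, and \<open>ln C\<close> is negligible against
  \<open>ln n\<close>. Positivity of the errors allows the use of monotonicity of
  \<open>ln\<close>.\<close>

lemma upper_qdim_le:
  fixes M :: "'a::euclidean_space measure"
  assumes "l > 0" "C > 0"
    and e: "\<And>n. n \<ge> 1 \<Longrightarrow> 0 < quant_e M r n \<and> quant_e M r n \<le> C * real n powr (-1/l)"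
  shows "upper_qdim M r \<le> ereal l"
proof -
  have lim: "((\<lambda>n. ln (real n) / (ln (real n) / l - ln C)) \<longlongrightarrow> l) sequentially"
    using \<open>l > 0\<close> by real_asymp
  have "filterlim (\<lambda>n. ln (real n) / l - ln C) at_top sequentially"
    using \<open>l > 0\<close> by real_asymp
  then have ev: "eventually (\<lambda>n. ln (real n) / l - ln C > 0) sequentially"
    unfolding filterlim_at_top_dense by blast
  have "eventually (\<lambda>n. ereal (ln (real n) / - ln (quant_e M r n))
      \<le> ereal (ln (real n) / (ln (real n) / l - ln C))) sequentially"
    using ev eventually_ge_at_top[of 1]
  proof eventually_elim
    case (elim n)
    have "ln (quant_e M r n) \<le> ln (C * real n powr (-1/l))"
      using e[OF elim(2)] by (subst ln_le_cancel_iff) auto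
    also have "\<dots> = ln C - ln (real n) / l"
      using elim \<open>C > 0\<close> by (simp add: ln_mult ln_powr)
    finally have "ln (real n) / l - ln C \<le> - ln (quant_e M r n)" by simp
    with elim have "ln (real n) / - ln (quant_e M r n) \<le> ln (real n) / (ln (real n) / l - ln C)"
      by (intro divide_left_mono mult_pos_pos) auto
    then show ?case by simp
  qed
  then have "upper_qdim M r \<le> limsup (\<lambda>n. ereal (ln (real n) / (ln (real n) / l - ln C)))"
    unfolding upper_qdim_def by (rule Limsup_mono)
  also have "\<dots> = ereal l"
    by (rule lim_imp_Limsup) (use lim in auto)
  finally show ?thesis .
qed

text \<open>\<open>small\<close> makes the denominator \<open>- ln (quant_e M r n)\<close> positive;
  the larger comparison denominator is then positive as well, so the quotients compare.\<close>

lemma lower_qdim_ge: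
  fixes M :: "'a::euclidean_space measure"
  assumes "k > 0" "C > 0"
    and e: "\<And>n. n \<ge> 1 \<Longrightarrow> C * real n powr (-1/k) \<le> quant_e M r n"
    and small: "eventually (\<lambda>n. quant_e M r n < 1) sequentially"
  shows "ereal k \<le> lower_qdim M r"
proof -
  have lim: "((\<lambda>n. ln (real n) / (ln (real n) / k - ln C)) \<longlongrightarrow> k) sequentially"
    using \<open>k > 0\<close> by real_asymp
  have "eventually (\<lambda>n. ereal (ln (real n) / (ln (real n) / k - ln C))
      \<le> ereal (ln (real n) / - ln (quant_e M r n))) sequentially"
    using small eventually_ge_at_top[of 1]
  proof eventually_elim
    case (elim n)
    have pos: "0 < C * real n powr (-1/k)" using elim \<open>C > 0\<close> by simp
    have "ln (C * real n powr (-1/k)) \<le> ln (quant_e M r n)"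
      using e[OF elim(2)] pos by (subst ln_le_cancel_iff) auto
    also have "ln (C * real n powr (-1/k)) = ln C - ln (real n) / k"
      using elim \<open>C > 0\<close> by (simp add: ln_mult ln_powr)
    finally have le: "- ln (quant_e M r n) \<le> ln (real n) / k - ln C" by simp
    have "0 < quant_e M r n" using pos e[OF elim(2)] by linarith
    with elim have "0 < - ln (quant_e M r n)" by simp
    moreover from this le have "0 < ln (real n) / k - ln C" by linarith
    ultimately have "ln (real n) / (ln (real n) / k - ln C) \<le> ln (real n) / - ln (quant_e M r n)"
      using le elim by (intro divide_left_mono mult_pos_pos) auto
    then show ?case by simp
  qed
  then have "liminf (\<lambda>n. ereal (ln (real n) / (ln (real n) / k - ln C))) \<le> lower_qdim M r"
    unfolding lower_qdim_def by (rule Liminf_mono)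
  also have "liminf (\<lambda>n. ereal (ln (real n) / (ln (real n) / k - ln C))) = ereal k"
    by (rule lim_imp_Liminf) (use lim in auto)
  finally show ?thesis .
qed

section \<open>A lower bound for separated systems\<close>

lemma powr_lt_one: "0 < x \<Longrightarrow> x < 1 \<Longrightarrow> 0 < a \<Longrightarrow> x powr a < 1" for x a :: real
  using powr_less_mono2[of a x 1] by simp

text \<open>Convexity of \<open>z powr (-\<rho>)\<close>: its tangent at 1 is summed with weights
  \<open>t i\<close> at the points \<open>z = m i / (t i * n)\<close>. If both sums attain their
  bounds, equality holds for \<open>m i = t i * n\<close>.\<close>

lemma sum_powr_weighted_lower:
  fixes t m :: "'i \<Rightarrow> real"
  assumes "finite I" "\<rho> > 0" "n > 0"
    and t: "\<And>i. i \<in> I \<Longrightarrow> t i > 0" "sum t I \<ge> 1"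
    and m: "\<And>i. i \<in> I \<Longrightarrow> m i > 0" "sum m I \<le> n"
  shows "n powr (-\<rho>) \<le> (\<Sum>i\<in>I. t i powr (1 + \<rho>) * m i powr (-\<rho>))"
proof -
  have tangent: "1 + \<rho> - \<rho> * z \<le> z powr (-\<rho>)" if "z > 0" for z :: real
  proof -
    have "1 + \<rho> - \<rho> * z \<le> 1 + (-\<rho>) * ln z"
      using mult_left_mono[OF ln_le_minus_one[OF that], of \<rho>] \<open>\<rho> > 0\<close> by (simp add: algebra_simps)
    also have "\<dots> \<le> exp ((-\<rho>) * ln z)" by (rule exp_ge_add_one_self)
    finally show ?thesis using that by (simp add: powr_def)
  qed
  \<comment> \<open>\<open>sum t I\<close> enters with a positive coefficient and
    \<open>sum m I\<close> with a negative one, so one-sided bounds on the two sums suffice.\<close>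
  have "1 \<le> (1 + \<rho>) * sum t I - \<rho> * (sum m I / n)"
  proof -
    have "(1 + \<rho>) * 1 \<le> (1 + \<rho>) * sum t I" using t \<open>\<rho> > 0\<close> by (intro mult_left_mono) auto
    moreover have "\<rho> * (sum m I / n) \<le> \<rho> * 1" using m \<open>\<rho> > 0\<close> \<open>n > 0\<close> by (intro mult_left_mono) auto
    ultimately show ?thesis by argo
  qed
  then have "n powr (-\<rho>) * 1 \<le> n powr (-\<rho>) * ((1 + \<rho>) * sum t I - \<rho> * (sum m I / n))"
    by (intro mult_left_mono) auto
  also have "\<dots> = (\<Sum>i\<in>I. n powr (-\<rho>) * (t i * (1 + \<rho> - \<rho> * (m i / (t i * n)))))"
  proof -
    have "(\<Sum>i\<in>I. t i * (1 + \<rho> - \<rho> * (m i / (t i * n)))) = (\<Sum>i\<in>I. (1 + \<rho>) * t i - \<rho> * (m i / n))"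
      using t(1) by (intro sum.cong refl) (force simp: field_simps)
    also have "\<dots> = (1 + \<rho>) * sum t I - \<rho> * (sum m I / n)"
      by (simp add: sum_subtractf sum_distrib_left sum_divide_distrib)
    finally show ?thesis by (simp add: sum_distrib_left[symmetric])
  qed
  also have "\<dots> \<le> (\<Sum>i\<in>I. t i powr (1 + \<rho>) * m i powr (-\<rho>))"
  proof (rule sum_mono)
    fix i assume i: "i \<in> I"
    have pos: "t i > 0" "m i > 0" using t m i by auto
    have "n powr (-\<rho>) * (t i * (1 + \<rho> - \<rho> * (m i / (t i * n))))
        \<le> n powr (-\<rho>) * (t i * (m i / (t i * n)) powr (-\<rho>))"
      using pos \<open>n > 0\<close> by (intro mult_left_mono tangent) auto
    also have "\<dots> = t i powr (1 + \<rho>) * m i powr (-\<rho>)"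
      using pos \<open>n > 0\<close> by (simp add: powr_divide powr_mult powr_minus powr_add field_simps)
    finally show "n powr (-\<rho>) * (t i * (1 + \<rho> - \<rho> * (m i / (t i * n))))
        \<le> t i powr (1 + \<rho>) * m i powr (-\<rho>)" .
  qed
  finally show ?thesis by simp
qed

text \<open>\<open>infdist x {}\<close> is 0, but having no centre must cost the maximum; hence the
  separate value \<open>d\<close>. Centre sets that become empty do occur in the induction
  below.\<close>

definition capdist :: "real \<Rightarrow> 'a::metric_space set \<Rightarrow> 'a \<Rightarrow> real" where
  "capdist d B x = (if B = {} then d else min d (infdist x B))"

lemma capdist_nonneg: "d \<ge> 0 \<Longrightarrow> 0 \<le> capdist d B x"
  by (simp add: capdist_def infdist_nonneg)

lemma capdist_le: "capdist d B x \<le> d"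
  by (simp add: capdist_def)

lemma borel_measurable_capdist [measurable]:
  "capdist d B \<in> borel_measurable (borel :: 'a::euclidean_space measure)"
proof -
  have "continuous_on UNIV (capdist d B)"
    unfolding capdist_def by (cases "B = {}") (auto intro!: continuous_intros)
  then show ?thesis by (rule borel_measurable_continuous_onI)
qed

text \<open>Because of the cap at \<open>d\<close>, centres farther than \<open>d\<close> from \<open>g x\<close> may be dropped from \<open>B\<close>; this is
  what makes the estimate reproduce itself under \<open>g\<close>.\<close>

lemma capdist_expand:
  fixes g :: "'a::euclidean_space \<Rightarrow> 'a"
  assumes "finite B" "surj g" "d > 0" "0 \<le> \<sigma>" "\<sigma> \<le> 1"
    and low: "\<And>x y. \<sigma> * dist x y \<le> dist (g x) (g y)"
    and near: "\<And>b. b \<in> B \<Longrightarrow> dist (g x) b < d \<Longrightarrow> b \<in> B'"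
  shows "\<sigma> * capdist d (g -` B') x \<le> capdist d B (g x)"
proof -
  \<comment> \<open>As \<open>\<sigma> \<le> 1\<close>, the left side stays below the cap, so only
    centres closer than \<open>d\<close> to \<open>g x\<close> can matter.\<close>
  have triv: "\<sigma> * capdist d (g -` B') x \<le> d"
  proof -
    have "\<sigma> * capdist d (g -` B') x \<le> 1 * capdist d (g -` B') x"
      using assms by (intro mult_right_mono capdist_nonneg) auto
    then show ?thesis using capdist_le[of d "g -` B'" x] by linarith
  qed
  show ?thesis
  proof (cases "B = {}")
    case True
    then show ?thesis using triv by (simp add: capdist_def)
  next
    case False
    obtain b where b: "b \<in> B" "infdist (g x) B = dist (g x) b"
      using infdist_attains_inf[OF finite_imp_closed[OF \<open>finite B\<close>] False] by metis
    have "\<sigma> * capdist d (g -` B') x \<le> dist (g x) b"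
    proof (cases "dist (g x) b < d")
      case True
      obtain y where y: "b = g y" using \<open>surj g\<close> by (auto simp: surj_def)
      have "y \<in> g -` B'" using near[OF b(1) True] y by simp
      then have "capdist d (g -` B') x \<le> dist x y"
        using infdist_le[of y "g -` B'" x] by (auto simp: capdist_def min_le_iff_disj)
      then have "\<sigma> * capdist d (g -` B') x \<le> \<sigma> * dist x y"
        using assms by (intro mult_left_mono) auto
      then show ?thesis using low[of x y] y by simp
    next
      case False
      then show ?thesis using triv by linarith
    qed
    then show ?thesis using b False triv by (simp add: capdist_def)
  qed
qed

text \<open>For the capped cost \<open>F\<close>, pulling the nearby centres back by each map gives
  sets whose cardinalities sum to at most \<open>card B\<close> and whose costs, weighted by
  \<open>a i\<close>, sum to at most \<open>F B\<close>; convexity then closes an induction on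
  \<open>card B\<close>. \<open>sub_inv\<close> is an inequality since the intended maps come from
  only some of the words of a given length.\<close>

lemma separated_lower_bound:
  fixes M :: "'a::euclidean_space measure" and g :: "'i \<Rightarrow> 'a \<Rightarrow> 'a" and q \<sigma> :: "'i \<Rightarrow> real"
  assumes M: "sets M = sets borel" "prob_space M" and AE_K: "AE x in M. x \<in> K"
    and I: "finite I" "card I \<ge> 2"
    and q: "\<And>i. i \<in> I \<Longrightarrow> 0 < q i" and \<sigma>: "\<And>i. i \<in> I \<Longrightarrow> 0 < \<sigma> i \<and> \<sigma> i \<le> 1"
    and surj: "\<And>i. i \<in> I \<Longrightarrow> surj (g i)"
    and low: "\<And>i x y. i \<in> I \<Longrightarrow> \<sigma> i * dist x y \<le> dist (g i x) (g i y)"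
    and sub_inv: "\<And>h. h \<in> borel_measurable borel \<Longrightarrow>
      (\<Sum>i\<in>I. ennreal (q i) * (\<integral>\<^sup>+x. h (g i x) \<partial>M)) \<le> (\<integral>\<^sup>+x. h x \<partial>M)"
    and sep: "d > 0" "\<And>i j x y. i \<in> I \<Longrightarrow> j \<in> I \<Longrightarrow> i \<noteq> j \<Longrightarrow> x \<in> K \<Longrightarrow> y \<in> K \<Longrightarrow>
      2 * d \<le> dist (g i x) (g j y)"
    and r: "r > 0" and \<rho>: "\<rho> > 0" "1 \<le> (\<Sum>i\<in>I. (q i * \<sigma> i powr r) powr (1 / (1 + \<rho>)))"
  obtains C where "C > 0" "\<And>B. finite B \<Longrightarrow> B \<noteq> {} \<Longrightarrow>
      ennreal (C * real (card B) powr (-\<rho>)) \<le> (\<integral>\<^sup>+x. ennreal (infdist x B powr r) \<partial>M)"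
proof -
  interpret prob_space M by fact
  define a where "a i = q i * \<sigma> i powr r" for i
  have a_pos: "a i > 0" if "i \<in> I" for i
    using q[OF that] \<sigma>[OF that] by (simp add: a_def)
  have I_ne: "I \<noteq> {}" using I by auto
  \<comment> \<open>Chosen so that one map left without centres, which contributes
    \<open>a i * d powr r\<close>, already pays for the claimed bound.\<close>
  define C where "C = Min (a ` I) * d powr r"
  have C_pos: "C > 0" using I I_ne a_pos sep(1) by (auto simp: C_def)
  have C_le: "C \<le> a i * d powr r" if "i \<in> I" for i
    unfolding C_def using that I by (intro mult_right_mono Min_le) auto
  define F where "F B = (\<integral>\<^sup>+x. ennreal (capdist d B x powr r) \<partial>M)" for B
  have F_empty: "F {} = ennreal (d powr r)"
    by (simp add: F_def capdist_def emeasure_space_1)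
  have meas_cap: "capdist d B \<in> borel_measurable M" for B
    using borel_measurable_capdist[of d B] M(1) by (simp cong: measurable_cong_sets)
  \<comment> \<open>By the cap, only centres within \<open>d\<close> of the image of
    \<open>K\<close> under \<open>g i\<close> affect the cost on that image.\<close>
  define near where "near B i = {b \<in> B. \<exists>x\<in>K. dist (g i x) b < d}" for B i
  \<comment> \<open>\<open>sub_inv\<close> provides one integral per map, and on \<open>K\<close>
    the lemma \<open>capdist_expand\<close> pulls each back at the price of the factor
    \<open>\<sigma> i powr r\<close>.\<close>
  have rec: "(\<Sum>i\<in>I. ennreal (a i) * F (g i -` near B i)) \<le> F B" if "finite B" for B
  proof -
    have "(\<Sum>i\<in>I. ennreal (a i) * F (g i -` near B i))
        \<le> (\<Sum>i\<in>I. ennreal (q i) * (\<integral>\<^sup>+x. ennreal (capdist d B (g i x) powr r) \<partial>M))"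
    proof (rule sum_mono)
      fix i assume i: "i \<in> I"
      have "ennreal (\<sigma> i powr r) * F (g i -` near B i)
          = (\<integral>\<^sup>+x. ennreal (\<sigma> i powr r) * ennreal (capdist d (g i -` near B i) x powr r) \<partial>M)"
        unfolding F_def using meas_cap by (subst nn_integral_cmult) auto
      also have "\<dots> \<le> (\<integral>\<^sup>+x. ennreal (capdist d B (g i x) powr r) \<partial>M)"
      proof (rule nn_integral_mono_AE, use AE_K in eventually_elim)
        case (elim x)
        have "\<sigma> i * capdist d (g i -` near B i) x \<le> capdist d B (g i x)"
          by (rule capdist_expand) (use that surj \<sigma> sep low i elim in \<open>auto simp: near_def less_imp_le\<close>)
        then have "(\<sigma> i * capdist d (g i -` near B i) x) powr r \<le> capdist d B (g i x) powr r"
          using \<sigma>[OF i] r sep(1) by (intro powr_mono2) (auto intro!: mult_nonneg_nonneg capdist_nonneg)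
        then show ?case
          using \<sigma>[OF i] sep(1)
          by (simp add: powr_mult capdist_nonneg ennreal_mult[symmetric] ennreal_leI)
      qed
      finally show "ennreal (a i) * F (g i -` near B i)
          \<le> ennreal (q i) * (\<integral>\<^sup>+x. ennreal (capdist d B (g i x) powr r) \<partial>M)"
        unfolding a_def using q[OF i]
        by (simp add: ennreal_mult mult.assoc mult_left_mono)
    qed
    also have "\<dots> \<le> F B" unfolding F_def by (intro sub_inv) measurable
    finally show ?thesis .
  qed
  have inj: "inj (g i)" if "i \<in> I" for i
  proof (rule injI)
    fix x y assume "g i x = g i y"
    then show "x = y" using low[OF that, of x y] \<sigma>[OF that] by (simp add: mult_le_0_iff)
  qed
  \<comment> \<open>Bijectivity of \<open>g i\<close> preserves the cardinality of the near sets,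
    and a centre in two of them would put points of two images at distance less than
    \<open>2 * d\<close>.\<close>
  have card_sum: "(\<Sum>i\<in>I. card (g i -` near B i)) \<le> card B" if "finite B" for B
  proof -
    have fin: "finite (near B i)" for i using that by (simp add: near_def)
    have "(\<Sum>i\<in>I. card (g i -` near B i)) = (\<Sum>i\<in>I. card (near B i))"
    proof (rule sum.cong[OF refl])
      fix i assume i: "i \<in> I"
      show "card (g i -` near B i) = card (near B i)"
        by (rule card_vimage_inj) (use inj[OF i] surj[OF i] in auto)
    qed
    also have "\<dots> = card (\<Union>i\<in>I. near B i)"
    proof (rule card_UN_disjoint[symmetric])
      show "\<forall>i\<in>I. \<forall>j\<in>I. i \<noteq> j \<longrightarrow> near B i \<inter> near B j = {}"
      proof (intro ballI impI equals0I)
        fix i j b assume ij: "i \<in> I" "j \<in> I" "i \<noteq> j" and "b \<in> near B i \<inter> near B j"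
        then obtain x y where "x \<in> K" "y \<in> K" "dist (g i x) b < d" "dist (g j y) b < d"
          by (auto simp: near_def)
        then show False
          using sep(2)[OF ij, of x y] dist_triangle2[of "g i x" "g j y" b] by linarith
      qed
    qed (use I fin in auto)
    also have "\<dots> \<le> card B" using that by (intro card_mono) (auto simp: near_def)
    finally show ?thesis .
  qed
  have main: "ennreal (C * real (card B) powr (-\<rho>)) \<le> F B" if "finite B" "B \<noteq> {}" for B
    using that
  proof (induction "card B" arbitrary: B rule: less_induct)
    case less
    define m where "m i = card (g i -` near B i)" for i
    have fin': "finite (g i -` near B i)" if "i \<in> I" for i
      using less.prems inj[OF that] by (intro finite_vimageI) (auto simp: near_def)
    have cB: "card B \<ge> 1" using less.prems by (simp add: Suc_le_eq card_gt_0_iff)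
    show ?case
    proof (cases "\<exists>i\<in>I. m i = 0")
      \<comment> \<open>The empty preimage has capped cost \<open>d powr r\<close>; this single
        summand suffices because \<open>real (card B) powr (-\<rho>)\<close> is at most 1.\<close>
      case True
      then obtain i where i: "i \<in> I" "g i -` near B i = {}" using fin' by (auto simp: m_def)
      have "C * real (card B) powr (-\<rho>) \<le> C * 1"
        using cB C_pos \<rho> by (intro mult_left_mono) (auto simp: powr_minus inverse_le_1_iff ge_one_powr_ge_zero)
      also have "\<dots> \<le> a i * d powr r" using C_le i by simp
      finally have "ennreal (C * real (card B) powr (-\<rho>)) \<le> ennreal (a i) * F (g i -` near B i)"
        using i a_pos by (simp add: F_empty ennreal_mult'[symmetric] ennreal_leI less_imp_le)
      also have "\<dots> \<le> (\<Sum>i\<in>I. ennreal (a i) * F (g i -` near B i))"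
        using i I by (intro member_le_sum) auto
      also have "\<dots> \<le> F B" by (rule rec) fact
      finally show ?thesis .
    next
      case False
      then have m_pos: "m i > 0" if "i \<in> I" for i using that by (metis gr0I)
      have m_sum: "sum m I \<le> card B" using card_sum[of B] less.prems by (simp add: m_def)
      \<comment> \<open>With at least two maps and at least one centre for each, no map receives all
        of them, so the induction hypothesis applies.\<close>
      have m_less: "m i < card B" if i: "i \<in> I" for i
      proof -
        have "card (I - {i}) > 0" using I i by (simp add: card_Diff_singleton)
        then obtain j where "j \<in> I" "j \<noteq> i" by (metis DiffE card_gt_0_iff ex_in_conv singletonI)
        then have "m i + m j = sum m {i, j}" by simp
        also have "\<dots> \<le> sum m I" using I i \<open>j \<in> I\<close> by (intro sum_mono2) auto
        finally show ?thesis using m_pos[OF \<open>j \<in> I\<close>] m_sum by linarith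
      qed
      have IH: "ennreal (C * real (m i) powr (-\<rho>)) \<le> F (g i -` near B i)" if i: "i \<in> I" for i
      proof -
        have "g i -` near B i \<noteq> {}" using m_pos[OF i] by (auto simp: m_def)
        with less.hyps[of "g i -` near B i"] m_less[OF i] fin'[OF i] show ?thesis by (simp add: m_def)
      qed
      \<comment> \<open>The weights are \<open>t i = a i powr (1 / (1 + \<rho>))\<close>, so that
        \<open>t i powr (1 + \<rho>) = a i\<close>; their sum is at least 1 by assumption.\<close>
      have "real (card B) powr (-\<rho>)
          \<le> (\<Sum>i\<in>I. (a i powr (1 / (1 + \<rho>))) powr (1 + \<rho>) * real (m i) powr (-\<rho>))"
        by (rule sum_powr_weighted_lower)
          (use I \<rho> cB a_pos less_imp_neq[OF a_pos] m_pos m_sum in \<open>auto simp: a_def[symmetric] of_nat_sum[symmetric] simp del: of_nat_sum\<close>)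
      also have "\<dots> = (\<Sum>i\<in>I. a i * real (m i) powr (-\<rho>))"
        using \<rho> by (intro sum.cong) (auto simp: powr_powr abs_of_pos[OF a_pos])
      finally have "C * real (card B) powr (-\<rho>) \<le> C * (\<Sum>i\<in>I. a i * real (m i) powr (-\<rho>))"
        using C_pos by simp
      also have "\<dots> = (\<Sum>i\<in>I. a i * (C * real (m i) powr (-\<rho>)))"
        by (simp add: sum_distrib_left mult_ac)
      finally have "ennreal (C * real (card B) powr (-\<rho>))
          \<le> (\<Sum>i\<in>I. ennreal (a i * (C * real (m i) powr (-\<rho>))))"
        using less_imp_le[OF a_pos] C_pos by (subst sum_ennreal) (auto intro!: ennreal_leI mult_nonneg_nonneg)
      also have "\<dots> = (\<Sum>i\<in>I. ennreal (a i) * ennreal (C * real (m i) powr (-\<rho>)))"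
        using a_pos by (intro sum.cong) (auto simp: ennreal_mult' less_imp_le)
      also have "\<dots> \<le> (\<Sum>i\<in>I. ennreal (a i) * F (g i -` near B i))"
        using IH by (intro sum_mono mult_left_mono) auto
      also have "\<dots> \<le> F B" by (rule rec) fact
      finally show ?thesis .
    qed
  qed
  show thesis
  proof (rule that[OF C_pos])
    fix B :: "'a set" assume B: "finite B" "B \<noteq> {}"
    have "F B \<le> (\<integral>\<^sup>+x. ennreal (infdist x B powr r) \<partial>M)"
      unfolding F_def
    proof (intro nn_integral_mono ennreal_leI powr_mono2)
      fix x show "capdist d B x \<le> infdist x B" using B by (simp add: capdist_def)
    qed (use r sep(1) in \<open>auto intro!: capdist_nonneg\<close>)
    with main[OF B] show "ennreal (C * real (card B) powr (-\<rho>)) \<le> (\<integral>\<^sup>+x. ennreal (infdist x B powr r) \<partial>M)"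
      by (rule order_trans)
  qed
qed


section \<open>Weighted iterated function systems\<close>

locale weighted_ifs =
  fixes N :: nat and f :: "nat \<Rightarrow> 'a::euclidean_space \<Rightarrow> 'a"
    and p s c :: "nat \<Rightarrow> real" and M :: "'a measure" and K :: "'a set"
  assumes N2: "N \<ge> 2"
    and p_pos: "i < N \<Longrightarrow> p i > 0" and p_sum: "(\<Sum>i<N. p i) = 1"
    and s_pos: "i < N \<Longrightarrow> 0 < s i" and s_le_c: "i < N \<Longrightarrow> s i \<le> c i" and c_less: "i < N \<Longrightarrow> c i < 1"
    and lower: "i < N \<Longrightarrow> s i * dist x y \<le> dist (f i x) (f i y)"
    and upper: "i < N \<Longrightarrow> dist (f i x) (f i y) \<le> c i * dist x y"
    and M_borel: "sets M = sets borel" and M_prob: "prob_space M"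
    and M_inv: "A \<in> sets borel \<Longrightarrow>
      emeasure M A = (\<Sum>i<N. ennreal (p i) * emeasure M (f i -` A))"
    and K_compact: "compact K" and K_ne: "K \<noteq> {}" and K_eq: "K = (\<Union>i<N. f i ` K)"
begin

section \<open>Elementary facts on the weights and the maps\<close>

sublocale prob_space M by (rule M_prob)

lemma c_pos: "i < N \<Longrightarrow> 0 < c i"
  using s_pos s_le_c by fastforce

lemma p_less: assumes "i < N" shows "p i < 1"
proof -
  define j where "j = (if i = 0 then 1 else 0 :: nat)"
  have j: "j < N" "j \<noteq> i" using N2 by (auto simp: j_def)
  have "p i + p j = sum p {i, j}" using j by simp
  also have "\<dots> \<le> sum p {..<N}" using assms j p_pos by (intro sum_mono2) (auto simp: less_imp_le)
  finally show ?thesis using p_sum p_pos[OF j(1)] by simp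
qed

lemma cont: "i < N \<Longrightarrow> continuous_on UNIV (f i)"
  using upper c_pos by (intro lipschitz_on_continuous_on[of "c i"] lipschitz_onI) (auto simp: less_imp_le)

lemma f_inj: assumes "i < N" shows "inj (f i)"
proof (rule injI)
  fix x y assume "f i x = f i y"
  then show "x = y" using lower[OF assms, of x y] s_pos[OF assms] by (simp add: mult_le_0_iff)
qed

text \<open>The range is open by invariance of domain and closed by the lower Lipschitz bound.\<close>

lemma f_surj: assumes i: "i < N" shows "surj (f i)"
proof -
  have "open (range (f i))"
    using invariance_of_domain[OF cont[OF i] open_UNIV f_inj[OF i]] .
  moreover have "closed (range (f i))"
    unfolding closed_sequential_limits
  proof (intro allI impI)
    fix X z assume X: "(\<forall>n. X n \<in> range (f i)) \<and> X \<longlonglongrightarrow> z"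
    then have "\<forall>n. \<exists>y. X n = f i y" by blast
    then obtain Y where Y: "\<And>n. X n = f i (Y n)" by metis
    have "Cauchy X" by (rule LIMSEQ_imp_Cauchy[OF conjunct2[OF X]])
    \<comment> \<open>Distances of preimages are at most \<open>1 / s i\<close> times those of the
      images, so completeness yields a limit \<open>y\<close>, and continuity gives
      \<open>f i y = z\<close>.\<close>
    have "Cauchy Y"
    proof (rule metric_CauchyI)
      fix e :: real assume "e > 0"
      then obtain n0 where n0: "\<And>m n. m \<ge> n0 \<Longrightarrow> n \<ge> n0 \<Longrightarrow> dist (X m) (X n) < s i * e"
        using metric_CauchyD[OF \<open>Cauchy X\<close>, of "s i * e"] s_pos[OF i] by auto
      show "\<exists>n0. \<forall>m\<ge>n0. \<forall>n\<ge>n0. dist (Y m) (Y n) < e"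
      proof (intro exI allI impI)
        fix m n assume "m \<ge> n0" "n \<ge> n0"
        then have "s i * dist (Y m) (Y n) < s i * e"
          using n0[of m n] lower[OF i, of "Y m" "Y n"] Y by simp
        then show "dist (Y m) (Y n) < e" using s_pos[OF i] by simp
      qed
    qed
    then obtain y where "Y \<longlonglongrightarrow> y" using Cauchy_convergent convergent_def by blast
    then have "(\<lambda>n. f i (Y n)) \<longlonglongrightarrow> f i y"
      by (intro continuous_on_tendsto_compose[OF cont[OF i]]) auto
    moreover have "X = (\<lambda>n. f i (Y n))" using Y by (rule ext)
    ultimately have "z = f i y" using X LIMSEQ_unique by blast
    then show "z \<in> range (f i)" by blast
  qed
  \<comment> \<open>The space is connected, so a nonempty clopen set is everything.\<close>
  ultimately show ?thesis
    using clopen[of "range (f i)"] by auto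
qed

lemma f_K: "i < N \<Longrightarrow> x \<in> K \<Longrightarrow> f i x \<in> K"
  using K_eq by blast

lemma measurable_f: "i < N \<Longrightarrow> f i \<in> borel_measurable borel"
  by (intro borel_measurable_continuous_onI cont)

text \<open>The invariance is the case of indicator functions; both sides respect sums, nonnegative
  multiples and increasing limits.\<close>

lemma nn_integral_inv:
  assumes "h \<in> borel_measurable borel"
  shows "(\<integral>\<^sup>+x. h x \<partial>M) = (\<Sum>i<N. ennreal (p i) * (\<integral>\<^sup>+x. h (f i x) \<partial>M))"
  using assms
proof (induction rule: borel_measurable_induct)
  case (cong g h)
  then show ?case by simp
next
  case (set A)
  have "(\<integral>\<^sup>+x. indicator A (f i x) \<partial>M) = emeasure M (f i -` A)" if "i < N" for i
  proof -
    have "f i -` A \<in> sets M"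
      using measurable_sets[OF measurable_f[OF that], of A] set M_borel by simp
    then show ?thesis by (simp add: nn_integral_indicator[symmetric] indicator_def vimage_def)
  qed
  with set show ?case using M_borel M_inv[of A] by simp
next
  case (mult u a)
  have "u \<in> borel_measurable M" "\<And>i. i < N \<Longrightarrow> (\<lambda>x. u (f i x)) \<in> borel_measurable M"
    using mult(2) measurable_f M_borel by (auto simp: measurable_compose cong: measurable_cong_sets)
  then show ?case using mult by (simp add: nn_integral_cmult sum_distrib_left mult_ac)
next
  case (add u v)
  have "u \<in> borel_measurable M" "\<And>i. i < N \<Longrightarrow> (\<lambda>x. u (f i x)) \<in> borel_measurable M"
    "v \<in> borel_measurable M" "\<And>i. i < N \<Longrightarrow> (\<lambda>x. v (f i x)) \<in> borel_measurable M"
    using add measurable_f M_borel by (auto simp: measurable_compose cong: measurable_cong_sets)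
  then show ?case using add by (simp add: nn_integral_add sum.distrib distrib_left)
next
  case (seq U)
  have m: "U n \<in> borel_measurable M" "\<And>i. i < N \<Longrightarrow> (\<lambda>x. U n (f i x)) \<in> borel_measurable M" for n
    using seq(1) measurable_f M_borel by (auto simp: measurable_compose cong: measurable_cong_sets)
  have inc: "incseq (\<lambda>n x. U n (f i x))" for i
    using seq(3) by (auto simp: incseq_def le_fun_def)
  have "(\<integral>\<^sup>+x. (SUP n. U n x) \<partial>M) = (SUP n. \<integral>\<^sup>+x. U n x \<partial>M)"
    using seq(3) m by (intro nn_integral_monotone_convergence_SUP)
  also have "\<dots> = (SUP n. \<Sum>i<N. ennreal (p i) * (\<integral>\<^sup>+x. U n (f i x) \<partial>M))"
    by (simp only: seq.IH)
  also have "\<dots> = (\<Sum>i<N. SUP n. ennreal (p i) * (\<integral>\<^sup>+x. U n (f i x) \<partial>M))"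
    using inc by (intro ennreal_SUP_sum) (auto simp: incseq_def le_fun_def intro!: mult_left_mono nn_integral_mono)
  also have "\<dots> = (\<Sum>i<N. ennreal (p i) * (\<integral>\<^sup>+x. (SUP n. U n (f i x)) \<partial>M))"
    using inc m by (intro sum.cong) (auto simp: nn_integral_monotone_convergence_SUP SUP_mult_left_ennreal)
  finally show ?case by (simp add: image_comp)
qed

section \<open>Concentration of the measure on the attractor\<close>

lemma contraction_ratio:
  obtains \<theta> where "0 < \<theta>" "\<theta> < 1" "\<And>i x y. i < N \<Longrightarrow> dist (f i x) (f i y) \<le> \<theta> * dist x y"
proof
  have ne: "c ` {..<N} \<noteq> {}" using N2 by (auto simp: lessThan_empty_iff)
  define \<theta> where "\<theta> = Max (c ` {..<N})"
  have le: "c i \<le> \<theta>" if "i < N" for i using that by (auto simp: \<theta>_def)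
  show "0 < \<theta>" using le[of 0] c_pos[of 0] N2 by simp
  show "\<theta> < 1" using ne c_less by (auto simp: \<theta>_def)
  show "dist (f i x) (f i y) \<le> \<theta> * dist x y" if "i < N" for i x y
    using upper[OF that, of x y] mult_right_mono[OF le[OF that], of "dist x y"] by simp
qed

text \<open>\<open>K\<close> is mapped into itself, so the image of a nearest point of
  \<open>K\<close> competes in the infimum.\<close>

lemma infdist_K_f:
  assumes "i < N" "0 \<le> \<theta>" "\<And>x y. dist (f i x) (f i y) \<le> \<theta> * dist x y"
  shows "infdist (f i x) K \<le> \<theta> * infdist x K"
proof -
  obtain y where y: "y \<in> K" "infdist x K = dist x y"
    using infdist_attains_inf[OF compact_imp_closed[OF K_compact] K_ne] by metis
  have "infdist (f i x) K \<le> dist (f i x) (f i y)" by (intro infdist_le f_K assms y)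
  with assms(3)[of x y] y show ?thesis by simp
qed

text \<open>The maps shrink the distance to \<open>K\<close> by \<open>\<theta>\<close>, so
  invariance bounds the mass beyond distance \<open>t\<close> by the mass beyond
  \<open>t / \<theta>\<close>. Iteration pushes the threshold to infinity, where no mass
  remains.\<close>

lemma AE_in_K: "AE x in M. x \<in> K"
proof -
  obtain \<theta> where \<theta>: "0 < \<theta>" "\<theta> < 1" "\<And>i x y. i < N \<Longrightarrow> dist (f i x) (f i y) \<le> \<theta> * dist x y"
    using contraction_ratio by metis
  define D where "D t = {x. t < infdist x K}" for t
  have "open (D t)" for t unfolding D_def by (intro open_Collect_less continuous_intros)
  then have D_meas: "D t \<in> sets borel" for t by simp
  have step: "emeasure M (D t) \<le> emeasure M (D (t / \<theta>))" for t
  proof -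
    have "emeasure M (D t) = (\<Sum>i<N. ennreal (p i) * emeasure M (f i -` D t))"
      by (rule M_inv) fact
    also have "\<dots> \<le> (\<Sum>i<N. ennreal (p i) * emeasure M (D (t / \<theta>)))"
    proof (intro sum_mono mult_left_mono emeasure_mono subsetI)
      fix i x assume "i \<in> {..<N}" "x \<in> f i -` D t"
      then have "t < \<theta> * infdist x K"
        using infdist_K_f[of i \<theta> x] \<theta> by (auto simp: D_def)
      then show "x \<in> D (t / \<theta>)" using \<theta> by (simp add: D_def field_simps)
    qed (use D_meas M_borel in auto)
    also have "\<dots> = emeasure M (D (t / \<theta>))"
      using p_sum p_pos sum_ennreal[of "{..<N}" p] by (simp add: sum_distrib_right[symmetric] less_imp_le)
    finally show ?thesis .
  qed
  have null: "emeasure M (D t) = 0" if "t > 0" for t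
  proof -
    have iter: "emeasure M (D t) \<le> emeasure M (D (t / \<theta> ^ n))" for n
    proof (induction n)
      case (Suc n)
      then show ?case using step[of "t / \<theta> ^ n"] by (simp add: field_simps)
    qed simp
    have grow: "filterlim (\<lambda>n. t / \<theta> ^ n) at_top sequentially"
      using \<theta> that by real_asymp
    \<comment> \<open>Continuity from above, available as the measure is finite; the intersection is
      empty because the thresholds tend to infinity.\<close>
    have "(\<lambda>n. emeasure M (D (t / \<theta> ^ n))) \<longlonglongrightarrow> emeasure M (\<Inter>n. D (t / \<theta> ^ n))"
    proof (rule Lim_emeasure_decseq)
      have "t / \<theta> ^ m \<le> t / \<theta> ^ n" if "m \<le> n" for m n
        using \<theta> \<open>t > 0\<close> that by (intro divide_left_mono power_decreasing) auto
      then show "decseq (\<lambda>n. D (t / \<theta> ^ n))"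
        by (fastforce simp: decseq_def D_def)
    qed (use D_meas M_borel in \<open>auto simp: emeasure_eq_measure\<close>)
    moreover have "(\<Inter>n. D (t / \<theta> ^ n)) = {}"
    proof (rule equals0I)
      fix x assume x: "x \<in> (\<Inter>n. D (t / \<theta> ^ n))"
      obtain n where "infdist x K < t / \<theta> ^ n"
        using grow unfolding filterlim_at_top_dense by (metis eventually_sequentially le_refl)
      moreover have "x \<in> D (t / \<theta> ^ n)" using x by blast
      ultimately show False by (simp add: D_def)
    qed
    ultimately have "emeasure M (D t) \<le> 0"
      using iter by (intro LIMSEQ_le_const) auto
    then show ?thesis by simp
  qed
  \<comment> \<open>Countably many thresholds exhaust all positive distances; \<open>K\<close> is
    closed, so distance 0 means membership.\<close>
  have "AE x in M. \<forall>n::nat. x \<notin> D (1 / real (Suc n))"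
    unfolding AE_all_countable
  proof
    fix n show "AE x in M. x \<notin> D (1 / real (Suc n))"
      using D_meas M_borel null by (intro AE_not_in) (auto simp: null_sets_def)
  qed
  then show ?thesis
  proof eventually_elim
    case (elim x)
    have "infdist x K \<le> 0"
    proof (rule ccontr)
      assume "\<not> infdist x K \<le> 0"
      then obtain n where "1 / real (Suc n) < infdist x K" using nat_approx_posE by (metis not_le)
      with elim show False by (auto simp: D_def)
    qed
    then have "infdist x K = 0" using infdist_nonneg[of x K] by linarith
    then show ?case using K_compact K_ne by (simp add: in_closed_iff_infdist_zero compact_imp_closed)
  qed
qed

subsection \<open>Upper bound\<close>

text \<open>Allowing a real budget \<open>x\<close> of centres lets the shares \<open>t i * x\<close> be passed on without rounding.\<close>

lemma quantizer_exists:
  assumes r: "r > 0" and l: "l > 0" "(\<Sum>i<N. (p i * c i powr r) powr (l / (r + l))) = 1"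
  obtains C where "C > 0" "\<And>x. x \<ge> 1 \<Longrightarrow> \<exists>B. finite B \<and> B \<noteq> {} \<and> real (card B) \<le> x \<and>
    (\<integral>\<^sup>+y. ennreal (infdist y B powr r) \<partial>M) \<le> ennreal (C * x powr (- (r / l)))"
proof -
  \<comment> \<open>The share of the budget given to the \<open>i\<close>-th piece; the equation for
    \<open>l\<close> says that the shares sum to 1.\<close>
  define t where "t i = (p i * c i powr r) powr (l / (r + l))" for i
  have a01: "0 < p i * c i powr r \<and> p i * c i powr r < 1" if "i < N" for i
  proof -
    have "c i powr r < 1" using c_less[OF that] c_pos[OF that] r by (simp add: powr_lt_one)
    then have "p i * c i powr r < 1 * 1"
      using p_pos[OF that] p_less[OF that] by (intro mult_strict_mono) auto
    then show ?thesis using p_pos[OF that] c_pos[OF that] by simp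
  qed
  have t_pos: "0 < t i" and t_less: "t i < 1" if "i < N" for i
    using a01[OF that] r l by (auto simp: t_def powr_lt_one)
  have t_sum: "(\<Sum>i<N. t i) = 1" using l by (simp add: t_def)
  have ne: "t ` {..<N} \<noteq> {}" using N2 by (auto simp: lessThan_empty_iff)
  define t0 where "t0 = Min (t ` {..<N})"
  define t1 where "t1 = Max (t ` {..<N})"
  have t0: "0 < t0" "\<And>i. i < N \<Longrightarrow> t0 \<le> t i" using ne t_pos by (auto simp: t0_def)
  have t1: "t1 < 1" "\<And>i. i < N \<Longrightarrow> t i \<le> t1" using ne t_less by (auto simp: t1_def)
  have t1_pos: "0 < t1" using t1(2)[of 0] t_pos[of 0] N2 by simp
  obtain y0 where y0: "y0 \<in> K" using K_ne by blast
  \<comment> \<open>The summand 1 keeps \<open>D\<close> positive even when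
    \<open>diameter K\<close> is 0.\<close>
  define D where "D = diameter K + 1"
  have D: "D > 0" "\<And>y. y \<in> K \<Longrightarrow> dist y y0 \<le> D"
    using y0 diameter_ge_0[OF compact_imp_bounded[OF K_compact]]
      diameter_bounded_bound[OF compact_imp_bounded[OF K_compact]]
    unfolding D_def by (auto intro: order_trans add_increasing2)
  \<comment> \<open>Chosen so that \<open>D powr r \<le> C * x powr (- (r / l))\<close> whenever
    \<open>1 \<le> x\<close> and \<open>x \<le> 1 / t0\<close>; then the single centre
    \<open>y0\<close> is good enough.\<close>
  define C where "C = D powr r * (1 / t0) powr (r / l)"
  have C_pos: "C > 0" using D t0 by (simp add: C_def)
  have base: "\<exists>B. finite B \<and> B \<noteq> {} \<and> real (card B) \<le> x \<and>
      (\<integral>\<^sup>+y. ennreal (infdist y B powr r) \<partial>M) \<le> ennreal (C * x powr (- (r / l)))"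
    if x: "1 \<le> x" "x * t0 \<le> 1" for x
  proof (intro exI conjI)
    have "x \<le> 1 / t0" using x t0(1) by (simp add: field_simps)
    then have "x powr (r / l) \<le> (1 / t0) powr (r / l)" using x r l by (intro powr_mono2) auto
    then have "D powr r * x powr (r / l) \<le> C" unfolding C_def by (intro mult_left_mono) auto
    then have le: "D powr r \<le> C * x powr (- (r / l))"
      using x by (simp add: powr_minus field_simps)
    have "(\<integral>\<^sup>+y. ennreal (infdist y {y0} powr r) \<partial>M) \<le> (\<integral>\<^sup>+y. ennreal (D powr r) \<partial>M)"
      using AE_in_K
      by (intro nn_integral_mono_AE, elim eventually_mono)
        (use D r in \<open>auto intro!: ennreal_leI powr_mono2\<close>)
    also have "\<dots> = ennreal (D powr r)" by (simp add: emeasure_space_1)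
    also have "\<dots> \<le> ennreal (C * x powr (- (r / l)))" using le by (rule ennreal_leI)
    finally show "(\<integral>\<^sup>+y. ennreal (infdist y {y0} powr r) \<partial>M) \<le> ennreal (C * x powr (- (r / l)))" .
  qed (use x in auto)
  \<comment> \<open>Induction on the scale \<open>m\<close>: passing to the share
    \<open>t i * x\<close> lowers it by one, as \<open>t i \<le> t1\<close>. The split at
    \<open>x * t0 \<le> 1\<close> decides between a single centre and shares that are all at least
    1.\<close>
  have claim: "\<exists>B. finite B \<and> B \<noteq> {} \<and> real (card B) \<le> x \<and>
    (\<integral>\<^sup>+y. ennreal (infdist y B powr r) \<partial>M) \<le> ennreal (C * x powr (- (r / l)))"
    if "1 \<le> x" "x * t1 ^ m \<le> 1" for x m
    using that
  proof (induction m arbitrary: x)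
    case 0
    have "t0 \<le> 1" using t0(2)[of 0] t_less[of 0] N2 by simp
    moreover have "x = 1" using 0 by simp
    ultimately show ?case by (intro base) auto
  next
    case (Suc m)
    show ?case
    proof (cases "x * t0 \<le> 1")
      case True
      then show ?thesis using base Suc.prems by blast
    next
      case False
      have ex: "\<exists>B. finite B \<and> B \<noteq> {} \<and> real (card B) \<le> t i * x \<and>
        (\<integral>\<^sup>+y. ennreal (infdist y B powr r) \<partial>M) \<le> ennreal (C * (t i * x) powr (- (r / l)))"
        if i: "i < N" for i
      proof (rule Suc.IH)
        have "x * t0 \<le> x * t i" using t0(2)[OF i] Suc.prems by simp
        then show "1 \<le> t i * x" using False by (simp add: mult.commute)
        have "t i * x * t1 ^ m \<le> t1 * x * t1 ^ m"
          using t1(2)[OF i] t1_pos Suc.prems by (intro mult_right_mono) auto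
        also have "\<dots> = x * t1 ^ Suc m" by simp
        finally show "t i * x * t1 ^ m \<le> 1" using Suc.prems by linarith
      qed
      then obtain B where B: "\<And>i. i < N \<Longrightarrow> finite (B i) \<and> B i \<noteq> {} \<and> real (card (B i)) \<le> t i * x \<and>
        (\<integral>\<^sup>+y. ennreal (infdist y (B i) powr r) \<partial>M) \<le> ennreal (C * (t i * x) powr (- (r / l)))"
        by metis
      define B' where "B' = (\<Union>i<N. f i ` B i)"
      have "card B' \<le> (\<Sum>i<N. card (f i ` B i))"
        unfolding B'_def by (rule card_UN_le) simp
      also have "\<dots> \<le> (\<Sum>i<N. card (B i))" using B by (intro sum_mono card_image_le) auto
      finally have "real (card B') \<le> (\<Sum>i<N. real (card (B i)))"
        by (metis of_nat_le_iff of_nat_sum)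
      also have "\<dots> \<le> (\<Sum>i<N. t i * x)" using B by (intro sum_mono) auto
      also have "\<dots> = x" using t_sum by (simp add: sum_distrib_right[symmetric])
      finally have card: "real (card B') \<le> x" .
      have near: "infdist (f i y) B' \<le> c i * infdist y (B i)" if i: "i < N" for i y
      proof -
        obtain b where b: "b \<in> B i" "infdist y (B i) = dist y b"
          using infdist_attains_inf[OF finite_imp_closed, of "B i" y] B[OF i] by metis
        have "infdist (f i y) B' \<le> dist (f i y) (f i b)"
          using b i by (intro infdist_le) (auto simp: B'_def)
        with upper[OF i, of y b] b show ?thesis by simp
      qed
      have "(\<integral>\<^sup>+y. ennreal (infdist y B' powr r) \<partial>M)
          = (\<Sum>i<N. ennreal (p i) * (\<integral>\<^sup>+y. ennreal (infdist (f i y) B' powr r) \<partial>M))"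
        by (rule nn_integral_inv) (measurable; intro borel_measurable_continuous_onI continuous_intros)
      also have "\<dots> \<le> (\<Sum>i<N. ennreal (t i * (C * x powr (- (r / l)))))"
      proof (rule sum_mono)
        fix i assume "i \<in> {..<N}"
        then have i: "i < N" by simp
        have "(\<lambda>y. infdist y (B i)) \<in> borel_measurable M"
          using borel_measurable_continuous_onI[OF continuous_on_infdist[OF continuous_on_id], of "B i"] M_borel
          by (simp cong: measurable_cong_sets)
        then have m: "(\<lambda>y. ennreal (infdist y (B i) powr r)) \<in> borel_measurable M" by measurable
        have "(\<integral>\<^sup>+y. ennreal (infdist (f i y) B' powr r) \<partial>M)
            \<le> (\<integral>\<^sup>+y. ennreal (c i powr r) * ennreal (infdist y (B i) powr r) \<partial>M)"
        proof (rule nn_integral_mono)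
          fix y
          have "infdist (f i y) B' powr r \<le> (c i * infdist y (B i)) powr r"
            using near[OF i] r by (intro powr_mono2) (auto simp: infdist_nonneg)
          then show "ennreal (infdist (f i y) B' powr r)
              \<le> ennreal (c i powr r) * ennreal (infdist y (B i) powr r)"
            using c_pos[OF i] by (simp add: powr_mult infdist_nonneg ennreal_mult[symmetric] ennreal_leI)
        qed
        also have "\<dots> = ennreal (c i powr r) * (\<integral>\<^sup>+y. ennreal (infdist y (B i) powr r) \<partial>M)"
          by (rule nn_integral_cmult) fact
        also have "\<dots> \<le> ennreal (c i powr r) * ennreal (C * (t i * x) powr (- (r / l)))"
          using B[OF i] by (intro mult_left_mono) auto
        finally have "ennreal (p i) * (\<integral>\<^sup>+y. ennreal (infdist (f i y) B' powr r) \<partial>M)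
            \<le> ennreal (p i) * (ennreal (c i powr r) * ennreal (C * (t i * x) powr (- (r / l))))"
          by (rule mult_left_mono) simp
        also have "\<dots> = ennreal (p i * c i powr r * (C * (t i * x) powr (- (r / l))))"
          using p_pos[OF i] C_pos by (simp add: ennreal_mult' mult.assoc)
        \<comment> \<open>By the choice of exponent, \<open>p i * c i powr r\<close> is
          \<open>t i powr (1 + r / l)\<close>; the factor \<open>t i powr (- (r / l))\<close>
          reduces this to \<open>t i\<close>, and these sum to 1.\<close>
        also have "p i * c i powr r * (C * (t i * x) powr (- (r / l))) = t i * (C * x powr (- (r / l)))"
        proof -
          have "l / (r + l) * (1 + r / l) = 1" using r l by (simp add: divide_simps)
          then have "p i * c i powr r = t i powr (1 + r / l)"
            using a01[OF i] by (simp only: t_def powr_powr) simp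
          then show ?thesis
            using t_pos[OF i] Suc.prems by (simp add: powr_mult powr_add powr_minus field_simps)
        qed
        finally show "ennreal (p i) * (\<integral>\<^sup>+y. ennreal (infdist (f i y) B' powr r) \<partial>M)
            \<le> ennreal (t i * (C * x powr (- (r / l))))" .
      qed
      also have "\<dots> = ennreal (C * x powr (- (r / l)))"
        using t_pos C_pos t_sum
        by (subst sum_ennreal) (auto simp: sum_distrib_right[symmetric] less_imp_le)
      finally have int: "(\<integral>\<^sup>+y. ennreal (infdist y B' powr r) \<partial>M) \<le> ennreal (C * x powr (- (r / l)))" .
      have "finite B'" "B' \<noteq> {}" using B N2 by (force simp: B'_def)+
      with card int show ?thesis by blast
    qed
  qed
  show thesis
  proof (rule that[OF C_pos claim])
    fix x :: real assume x: "x \<ge> 1"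
    then show "1 \<le> x" .
    have "(\<lambda>m. x * t1 ^ m) \<longlonglongrightarrow> x * 0"
      using t1_pos t1(1) by (intro tendsto_intros LIMSEQ_power_zero) auto
    then have "eventually (\<lambda>m. x * t1 ^ m < 1) sequentially" by (auto intro: order_tendstoD)
    then have ex: "\<exists>m. x * t1 ^ m \<le> 1" unfolding eventually_sequentially by (meson less_imp_le order_refl)
    \<comment> \<open>\<open>claim\<close> leaves \<open>m\<close> open; any scale that fits the
      given \<open>x\<close> serves.\<close>
    show "x * t1 ^ (SOME m. x * t1 ^ m \<le> 1) \<le> 1" by (rule someI_ex) fact
  qed
qed

subsection \<open>Words\<close>

definition words :: "nat \<Rightarrow> nat list set" where
  "words m = {w. set w \<subseteq> {..<N} \<and> length w = m}"

text \<open>The first letter acts last: a suffix decides what happens to \<open>K\<close> first, and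
  the prefix decides in which piece the image ends up.\<close>

definition wmap :: "nat list \<Rightarrow> 'a \<Rightarrow> 'a" where
  "wmap w = foldr f w"

definition wprod :: "(nat \<Rightarrow> real) \<Rightarrow> nat list \<Rightarrow> real" where
  "wprod a w = (\<Prod>i\<leftarrow>w. a i)"

lemma wmap_simps [simp]: "wmap [] x = x" "wmap (i # w) x = f i (wmap w x)"
  by (simp_all add: wmap_def)

lemma wmap_append: "wmap (u @ v) x = wmap u (wmap v x)"
  by (simp add: wmap_def)

lemma wprod_simps [simp]: "wprod a [] = 1" "wprod a (i # w) = a i * wprod a w"
  "wprod a (u @ v) = wprod a u * wprod a v"
  by (simp_all add: wprod_def)

lemma words_0: "words 0 = {[]}"
  by (auto simp: words_def)

lemma words_Suc: "words (Suc m) = (\<lambda>(i, w). i # w) ` ({..<N} \<times> words m)"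
  by (force simp: words_def length_Suc_conv)

lemma finite_words: "finite (words m)"
  by (simp add: words_def finite_lists_length_eq)

lemma sum_words_Suc: "(\<Sum>w\<in>words (Suc m). F w) = (\<Sum>i<N. \<Sum>w\<in>words m. F (i # w))"
  unfolding words_Suc
  by (subst sum.reindex) (auto simp: inj_on_def sum.cartesian_product intro!: sum.cong)

lemma wprod_pos:
  assumes "\<And>i. i < N \<Longrightarrow> 0 < a i" "set w \<subseteq> {..<N}"
  shows "0 < wprod a w"
  using assms(2) by (induction w) (auto intro!: mult_pos_pos assms(1))

text \<open>Such weights are multiplicative in the letters; with \<open>sum_wprod\<close> their sum
  over the words of length \<open>m\<close> becomes an \<open>m\<close>-th power.\<close>

lemma wprod_mult_powr:
  assumes "\<And>i. i < N \<Longrightarrow> 0 < a i" "\<And>i. i < N \<Longrightarrow> 0 < b i" "set w \<subseteq> {..<N}"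
  shows "(wprod a w * wprod b w powr r) powr t = wprod (\<lambda>i. (a i * b i powr r) powr t) w"
  using assms(3)
proof (induction w)
  case (Cons i w)
  then have "i < N" "set w \<subseteq> {..<N}" by auto
  then have "0 < wprod a w" "0 < wprod b w" "0 < a i" "0 < b i"
    by (auto intro: wprod_pos assms)
  then have "(wprod a (i # w) * wprod b (i # w) powr r) powr t
      = (a i * b i powr r) powr t * (wprod a w * wprod b w powr r) powr t"
    by (simp add: powr_mult mult_ac)
  with Cons show ?case by simp
qed simp

lemma sum_wprod: "(\<Sum>w\<in>words m. wprod a w) = (\<Sum>i<N. a i) ^ m"
proof (induction m)
  case (Suc m)
  then show ?case by (simp add: sum_words_Suc sum_distrib_left[symmetric] sum_distrib_right[symmetric])
qed (simp add: words_0)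

lemma wmap_surj: "set w \<subseteq> {..<N} \<Longrightarrow> surj (wmap w)"
proof (induction w)
  case (Cons i w)
  then have "surj (f i \<circ> wmap w)" by (intro comp_surj f_surj) auto
  then show ?case by (simp add: comp_def)
qed (simp add: wmap_def)

lemma wmap_cont: "set w \<subseteq> {..<N} \<Longrightarrow> continuous_on UNIV (wmap w)"
proof (induction w)
  case (Cons i w)
  then have "continuous_on UNIV (f i \<circ> wmap w)"
    by (intro continuous_on_compose continuous_on_subset[OF cont]) auto
  then show ?case by (simp add: comp_def)
qed (simp add: wmap_def)

lemma wmap_lower: "set w \<subseteq> {..<N} \<Longrightarrow> wprod s w * dist x y \<le> dist (wmap w x) (wmap w y)"
proof (induction w)
  case (Cons i w)
  then have i: "i < N" by simp
  have "wprod s (i # w) * dist x y = s i * (wprod s w * dist x y)" by simp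
  also have "\<dots> \<le> s i * dist (wmap w x) (wmap w y)"
    using Cons s_pos[OF i] by (intro mult_left_mono) auto
  also have "\<dots> \<le> dist (wmap (i # w) x) (wmap (i # w) y)" using lower[OF i] by simp
  finally show ?case .
qed simp

lemma wmap_upper:
  assumes "0 \<le> \<theta>" "\<And>i x y. i < N \<Longrightarrow> dist (f i x) (f i y) \<le> \<theta> * dist x y"
  shows "set w \<subseteq> {..<N} \<Longrightarrow> dist (wmap w x) (wmap w y) \<le> \<theta> ^ length w * dist x y"
proof (induction w)
  case (Cons i w)
  then have "dist (wmap (i # w) x) (wmap (i # w) y) \<le> \<theta> * dist (wmap w x) (wmap w y)"
    using assms(2)[of i] by simp
  also have "\<dots> \<le> \<theta> * (\<theta> ^ length w * dist x y)"
    using Cons assms(1) by (intro mult_left_mono) auto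
  finally show ?case by (simp add: mult_ac)
qed simp

lemma K_word: "x \<in> K \<Longrightarrow> \<exists>w\<in>words m. \<exists>y\<in>K. x = wmap w y"
proof (induction m arbitrary: x)
  case (Suc m)
  then obtain i y where i: "i < N" "y \<in> K" "x = f i y" using K_eq by blast
  with Suc.IH[of y] obtain w z where "w \<in> words m" "z \<in> K" "y = wmap w z" by blast
  with i have "i # w \<in> words (Suc m)" "x = wmap (i # w) z" by (auto simp: words_def)
  with \<open>z \<in> K\<close> show ?case by blast
qed (auto simp: words_0)

text \<open>Iterated invariance: the first letter is split off, and the induction hypothesis is used
  for the integrand composed with \<open>f i\<close>.\<close>

lemma nn_integral_words:
  assumes "h \<in> borel_measurable borel"
  shows "(\<integral>\<^sup>+x. h x \<partial>M) = (\<Sum>w\<in>words m. ennreal (wprod p w) * (\<integral>\<^sup>+x. h (wmap w x) \<partial>M))"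
  using assms
proof (induction m arbitrary: h)
  case (Suc m)
  have "(\<integral>\<^sup>+x. h x \<partial>M) = (\<Sum>i<N. ennreal (p i) * (\<integral>\<^sup>+x. h (f i x) \<partial>M))"
    by (rule nn_integral_inv) fact
  also have "\<dots> = (\<Sum>i<N. ennreal (p i) *
      (\<Sum>w\<in>words m. ennreal (wprod p w) * (\<integral>\<^sup>+x. h (f i (wmap w x)) \<partial>M)))"
    using Suc.prems measurable_f by (intro sum.cong refl arg_cong2[where f = "(*)"] Suc.IH) auto
  also have "\<dots> = (\<Sum>w\<in>words (Suc m). ennreal (wprod p w) * (\<integral>\<^sup>+x. h (wmap w x) \<partial>M))"
    unfolding sum_words_Suc sum_distrib_left
    using p_pos by (intro sum.cong refl) (simp add: ennreal_mult' less_imp_le mult.assoc)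
  finally show ?case .
qed (simp add: words_0)

subsection \<open>Lower bound\<close>

text \<open>Some word of length \<open>m\<close> maps \<open>K\<close> onto a set containing a given
  point of \<open>U \<inter> K\<close>. This set has diameter at most
  \<open>\<theta> ^ m * diameter K\<close>, hence for large \<open>m\<close> it fits into a ball
  inside \<open>U\<close>.\<close>

lemma word_inside:
  assumes "open U" "U \<inter> K \<noteq> {}"
  obtains w where "set w \<subseteq> {..<N}" "\<And>x. x \<in> K \<Longrightarrow> wmap w x \<in> U"
proof -
  obtain \<theta> where \<theta>: "0 < \<theta>" "\<theta> < 1" "\<And>i x y. i < N \<Longrightarrow> dist (f i x) (f i y) \<le> \<theta> * dist x y"
    using contraction_ratio by metis
  obtain x0 e where x0: "x0 \<in> K" "e > 0" "ball x0 e \<subseteq> U"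
    using assms open_contains_ball by blast
  have "(\<lambda>m. \<theta> ^ m * diameter K) \<longlonglongrightarrow> 0 * diameter K"
    using \<theta> by (intro tendsto_intros LIMSEQ_power_zero) auto
  then have "eventually (\<lambda>m. \<theta> ^ m * diameter K < e) sequentially"
    using x0 by (auto intro: order_tendstoD)
  then obtain m where m: "\<theta> ^ m * diameter K < e" by (auto simp: eventually_sequentially)
  obtain w y where w: "w \<in> words m" "y \<in> K" "x0 = wmap w y" using K_word[OF x0(1)] by blast
  show thesis
  proof
    show "set w \<subseteq> {..<N}" using w by (simp add: words_def)
    fix x assume "x \<in> K"
    have "dist x0 (wmap w x) \<le> \<theta> ^ m * dist y x"
      using wmap_upper[of \<theta> w y x] \<theta> w by (auto simp: words_def)
    also have "\<dots> \<le> \<theta> ^ m * diameter K"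
      using \<theta> w \<open>x \<in> K\<close> diameter_bounded_bound[OF compact_imp_bounded[OF K_compact]]
      by (intro mult_left_mono) auto
    finally show "wmap w x \<in> U" using m x0 by (auto simp: subset_iff)
  qed
qed

text \<open>At the first letter where the words differ, the images lie in disjoint copies of
  \<open>U\<close>; the common prefix is removed by injectivity. This concerns points of
  \<open>U\<close> only, whence the suffix that maps \<open>K\<close> into \<open>U\<close>
  below.\<close>

lemma words_separated:
  assumes U: "\<And>i. i < N \<Longrightarrow> f i ` U \<subseteq> U"
    "\<And>i j. i < N \<Longrightarrow> j < N \<Longrightarrow> i \<noteq> j \<Longrightarrow> f i ` U \<inter> f j ` U = {}"
    and w: "w \<in> words m" "v \<in> words m" "w \<noteq> v" and xy: "x \<in> U" "y \<in> U"
  shows "wmap w x \<noteq> wmap v y"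
  using w
proof (induction m arbitrary: w v)
  case (Suc m)
  have in_U: "wmap w x \<in> U" if "set w \<subseteq> {..<N}" "x \<in> U" for w x
    using that U(1) by (induction w) auto
  from Suc.prems obtain i w' j v' where
    wv: "w = i # w'" "v = j # v'" "i < N" "j < N" "w' \<in> words m" "v' \<in> words m"
    by (auto simp: words_Suc)
  show ?case
  proof (cases "i = j")
    case True
    then have "wmap w' x \<noteq> wmap v' y" using Suc wv by auto
    then show ?thesis using True wv f_inj[of i] by (auto dest: injD)
  next
    case False
    have "wmap w' x \<in> U" "wmap v' y \<in> U" using in_U wv xy by (auto simp: words_def)
    then show ?thesis using U(2)[OF wv(3,4) False] wv by auto
  qed
qed (auto simp: words_0)

text \<open>The suffix \<open>v\<close> that forces separation costs the factor
  \<open>wprod b v\<close>. For \<open>k' < k\<close> the letter weights \<open>b i\<close> sum to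
  more than 1, so the sum over prefixes of length \<open>m\<close> grows geometrically and outweighs
  that factor.\<close>

lemma quantizer_lower:
  assumes sosc: "SOSC N f K" and r: "r > 0"
    and k: "0 < k'" "k' < k" "(\<Sum>i<N. (p i * s i powr r) powr (k / (r + k))) = 1"
  obtains C where "C > 0" "\<And>B. finite B \<Longrightarrow> B \<noteq> {} \<Longrightarrow>
      ennreal (C * real (card B) powr (- (r / k'))) \<le> (\<integral>\<^sup>+x. ennreal (infdist x B powr r) \<partial>M)"
proof -
  obtain U where U: "open U" "\<And>i. i < N \<Longrightarrow> f i ` U \<subseteq> U"
    "\<And>i j. i < N \<Longrightarrow> j < N \<Longrightarrow> i \<noteq> j \<Longrightarrow> f i ` U \<inter> f j ` U = {}" "U \<inter> K \<noteq> {}"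
    using sosc unfolding SOSC_def by metis
  obtain v where v: "set v \<subseteq> {..<N}" "\<And>x. x \<in> K \<Longrightarrow> wmap v x \<in> U"
    using word_inside[OF U(1,4)] by metis
  define \<kappa> where "\<kappa> = k' / (r + k')"
  define b where "b i = (p i * s i powr r) powr \<kappa>" for i
  \<comment> \<open>\<open>x / (r + x)\<close> increases with \<open>x\<close>, and powers of
    numbers in (0, 1) grow as the exponent drops.\<close>
  have \<kappa>: "\<kappa> < k / (r + k)" using r k by (simp add: \<kappa>_def field_simps)
  have b_pos: "b i > 0" if "i < N" for i using p_pos[OF that] s_pos[OF that] by (simp add: b_def)
  have "(\<Sum>i<N. (p i * s i powr r) powr (k / (r + k))) < (\<Sum>i<N. b i)"
  proof (rule sum_strict_mono)
    fix i assume "i \<in> {..<N}"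
    then have i: "i < N" by simp
    have "s i < 1" using s_le_c[OF i] c_less[OF i] by simp
    then have "s i powr r < 1" using s_pos[OF i] r by (simp add: powr_lt_one)
    then have "p i * s i powr r < 1 * 1"
      using p_pos[OF i] p_less[OF i] by (intro mult_strict_mono) auto
    then show "(p i * s i powr r) powr (k / (r + k)) < b i"
      unfolding b_def using \<kappa> p_pos[OF i] s_pos[OF i] by (intro powr_less_mono') auto
  qed (use N2 in \<open>auto simp: lessThan_empty_iff\<close>)
  then have b_sum: "1 < (\<Sum>i<N. b i)" using k by simp
  have "0 < wprod b v" by (rule wprod_pos[OF b_pos v(1)])
  moreover have "filterlim (\<lambda>m. a * S ^ m) at_top sequentially" if "a > 0" "S > 1" for a S :: real
    using that by real_asymp
  ultimately have "filterlim (\<lambda>m. wprod b v * (\<Sum>i<N. b i) ^ m) at_top sequentially"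
    using b_sum by blast
  then have "eventually (\<lambda>m. 1 \<le> wprod b v * (\<Sum>i<N. b i) ^ m) sequentially"
    unfolding filterlim_at_top by blast
  \<comment> \<open>\<open>m \<ge> 1\<close> secures at least two words.\<close>
  then obtain m where m: "1 \<le> wprod b v * (\<Sum>i<N. b i) ^ m" "m \<ge> 1"
    unfolding eventually_sequentially by (metis nle_le)
  define g where "g w = wmap (w @ v)" for w
  have wv: "set (w @ v) \<subseteq> {..<N}" if "w \<in> words m" for w
    using that v by (auto simp: words_def)
  have compact_g: "compact (g w ` K)" if "w \<in> words m" for w
    unfolding g_def using K_compact wmap_cont[OF wv[OF that]]
    by (intro compact_continuous_image) (auto intro: continuous_on_subset)
  \<comment> \<open>Disjoint compact images have positive distance, and there are finitely many
    pairs of words.\<close>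
  have "\<exists>d>0. \<forall>w\<in>words m. \<forall>u\<in>words m. w \<noteq> u \<longrightarrow> (\<forall>x\<in>K. \<forall>y\<in>K. 2 * d \<le> dist (g w x) (g u y))"
  proof -
    define P where "P = {(w, u). w \<in> words m \<and> u \<in> words m \<and> w \<noteq> u}"
    have finP: "finite P"
      by (rule finite_subset[of _ "words m \<times> words m"]) (auto simp: P_def finite_words)
    have ex: "\<exists>e>0. \<forall>x\<in>K. \<forall>y\<in>K. e \<le> dist (g w x) (g u y)" if "(w, u) \<in> P" for w u
    proof -
      have wu: "w \<in> words m" "u \<in> words m" using that by (auto simp: P_def)
      have "g w ` K \<inter> g u ` K = {}"
        using words_separated[OF U(2,3), of w m u] v that by (force simp: P_def g_def wmap_append)
      then obtain e where "e > 0" "\<forall>x\<in>g w ` K. \<forall>y\<in>g u ` K. e \<le> dist x y"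
        using separate_compact_closed[OF compact_g[OF wu(1)] compact_imp_closed[OF compact_g[OF wu(2)]]] by blast
      then show ?thesis by blast
    qed
    then obtain e where e: "\<And>w u. (w, u) \<in> P \<Longrightarrow> e w u > 0"
      "\<And>w u x y. (w, u) \<in> P \<Longrightarrow> x \<in> K \<Longrightarrow> y \<in> K \<Longrightarrow> e w u \<le> dist (g w x) (g u y)"
      by metis
    \<comment> \<open>The element 1 keeps the set under \<open>Min\<close> nonempty; half of this
      minimum is the required distance.\<close>
    define d where "d = Min (insert 1 ((\<lambda>(w, u). e w u) ` P))"
    have "d > 0" using e(1) finP by (auto simp: d_def)
    moreover have "d \<le> dist (g w x) (g u y)" if "(w, u) \<in> P" "x \<in> K" "y \<in> K" for w u x y
    proof -
      have "d \<le> e w u" unfolding d_def using finP that by (intro Min_le) force+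
      with e(2)[OF that] show ?thesis by linarith
    qed
    ultimately show ?thesis by (intro exI[of _ "d / 2"]) (auto simp: P_def)
  qed
  then obtain d where d: "d > 0"
    "\<And>w u x y. w \<in> words m \<Longrightarrow> u \<in> words m \<Longrightarrow> w \<noteq> u \<Longrightarrow> x \<in> K \<Longrightarrow> y \<in> K \<Longrightarrow>
      2 * d \<le> dist (g w x) (g u y)"
    by metis
  show thesis
  proof (rule separated_lower_bound[OF M_borel M_prob AE_in_K finite_words[of m], where
        q = "\<lambda>w. wprod p (w @ v)" and \<sigma> = "\<lambda>w. wprod s (w @ v)" and g = g and d = d and r = r
        and \<rho> = "r / k'"])
    have "N ^ 1 \<le> N ^ m" using N2 m by (intro power_increasing) auto
    then show "2 \<le> card (words m)"
      using N2 card_lists_length_eq[of "{..<N}" m] by (simp add: words_def)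
    show "0 < wprod p (w @ v)" if "w \<in> words m" for w
      by (rule wprod_pos[OF p_pos wv[OF that]])
    show "0 < wprod s (w @ v) \<and> wprod s (w @ v) \<le> 1" if "w \<in> words m" for w
    proof
      show pos: "0 < wprod s (w @ v)" by (rule wprod_pos[OF s_pos wv[OF that]])
      have "wprod s u \<le> 1" if "set u \<subseteq> {..<N}" for u
        using that
      proof (induction u)
        case (Cons i u)
        then have "s i \<le> 1" "0 \<le> wprod s u" "0 \<le> s i"
          using s_le_c[of i] c_less[of i] s_pos[of i] wprod_pos[of s u, OF s_pos] by auto
        with Cons show ?case by (auto intro!: mult_le_one)
      qed simp
      then show "wprod s (w @ v) \<le> 1" using wv[OF that] by blast
    qed
    show "surj (g w)" "wprod s (w @ v) * dist x y \<le> dist (g w x) (g w y)" if "w \<in> words m" for w x y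
      unfolding g_def using wv[OF that] by (rule wmap_surj wmap_lower)+
    show "(\<Sum>w\<in>words m. ennreal (wprod p (w @ v)) * (\<integral>\<^sup>+x. h (g w x) \<partial>M)) \<le> (\<integral>\<^sup>+x. h x \<partial>M)"
      if h: "h \<in> borel_measurable borel" for h
    proof -
      have inj: "inj_on (\<lambda>w. w @ v) (words m)" by (simp add: inj_on_def)
      have "(\<Sum>w\<in>words m. ennreal (wprod p (w @ v)) * (\<integral>\<^sup>+x. h (g w x) \<partial>M))
          = (\<Sum>w\<in>(\<lambda>w. w @ v) ` words m. ennreal (wprod p w) * (\<integral>\<^sup>+x. h (wmap w x) \<partial>M))"
        unfolding g_def by (subst sum.reindex[OF inj]) simp
      \<comment> \<open>The extended words are some of the words of length
        \<open>m + length v\<close>, and the remaining terms are nonnegative.\<close>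
      also have "\<dots> \<le> (\<Sum>w\<in>words (m + length v). ennreal (wprod p w) * (\<integral>\<^sup>+x. h (wmap w x) \<partial>M))"
        using v by (intro sum_mono2 finite_words) (auto simp: words_def)
      also have "\<dots> = (\<integral>\<^sup>+x. h x \<partial>M)" by (rule nn_integral_words[OF h, symmetric])
      finally show ?thesis .
    qed
    \<comment> \<open>This identity matches the exponent in \<open>separated_lower_bound\<close> for
      \<open>\<rho> = r / k'\<close> with that of the weights \<open>b\<close>, so the sum factors
      over the letters.\<close>
    have "1 / (1 + r / k') = \<kappa>" using k r by (simp add: \<kappa>_def field_simps)
    then have "(\<Sum>w\<in>words m. (wprod p (w @ v) * wprod s (w @ v) powr r) powr (1 / (1 + r / k')))
        = (\<Sum>w\<in>words m. wprod b (w @ v))"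
      unfolding b_def using wprod_mult_powr[OF p_pos s_pos wv] by (intro sum.cong) auto
    also have "\<dots> = wprod b v * (\<Sum>i<N. b i) ^ m"
      by (simp add: sum_wprod[symmetric] sum_distrib_left mult.commute)
    finally show "1 \<le> (\<Sum>w\<in>words m. (wprod p (w @ v) * wprod s (w @ v) powr r) powr (1 / (1 + r / k')))"
      using m by simp
  qed (use d r k that in auto)
qed

end

text \<open>One quantizer bounds the infimum above; a lower bound for \<open>card B\<close> centres
  passes to \<open>n \<ge> card B\<close> because the power is decreasing. The upper bound also
  makes \<open>quant_V\<close> finite, so \<open>enn2real\<close> loses nothing, and the
  \<open>r\<close>-th root turns the exponent \<open>r / l\<close> into
  \<open>1 / l\<close>.\<close>

lemma quant_V_bounds_imp_quant_e:
  fixes M :: "'a::euclidean_space measure"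
  assumes r: "r > 0" and C: "C > 0" "C' > 0" and n: "n \<ge> 1"
    and up: "\<exists>B. finite B \<and> B \<noteq> {} \<and> real (card B) \<le> real n \<and>
      (\<integral>\<^sup>+y. ennreal (infdist y B powr r) \<partial>M) \<le> ennreal (C * real n powr (- (r / l)))"
    and low: "\<And>B. finite B \<Longrightarrow> B \<noteq> {} \<Longrightarrow>
      ennreal (C' * real (card B) powr (- (r / k))) \<le> (\<integral>\<^sup>+x. ennreal (infdist x B powr r) \<partial>M)"
    and k: "k > 0"
  shows "quant_e M r n \<le> C powr (1/r) * real n powr (-1/l)"
    and "C' powr (1/r) * real n powr (-1/k) \<le> quant_e M r n"
proof -
  have V_le: "quant_V M r n \<le> ennreal (C * real n powr (- (r / l)))"
  proof -
    obtain B where "finite B" "B \<noteq> {}" "card B \<le> n"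
      "(\<integral>\<^sup>+y. ennreal (infdist y B powr r) \<partial>M) \<le> ennreal (C * real n powr (- (r / l)))"
      using up by auto
    then show ?thesis unfolding quant_V_def by (intro Inf_lower2) auto
  qed
  have V_ge: "ennreal (C' * real n powr (- (r / k))) \<le> quant_V M r n"
    unfolding quant_V_def
  proof (rule Inf_greatest)
    fix z assume "z \<in> {(\<integral>\<^sup>+ x. ennreal (infdist x B powr r) \<partial>M) | B. finite B \<and> B \<noteq> {} \<and> card B \<le> n}"
    then obtain B where B: "z = (\<integral>\<^sup>+ x. ennreal (infdist x B powr r) \<partial>M)"
      "finite B" "B \<noteq> {}" "card B \<le> n" by blast
    have "0 < card B" using B by (simp add: card_gt_0_iff)
    then have "C' * real n powr (- (r / k)) \<le> C' * real (card B) powr (- (r / k))"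
      using B C r k by (intro mult_left_mono powr_mono2') auto
    then show "ennreal (C' * real n powr (- (r / k))) \<le> z"
      using low[OF B(2,3)] B(1) by (metis ennreal_leI order_trans)
  qed
  define E where "E = enn2real (quant_V M r n)"
  have fin: "quant_V M r n < \<top>" using V_le by (simp add: le_less_trans[OF _ ennreal_less_top])
  have E_le: "E \<le> C * real n powr (- (r / l))"
    unfolding E_def using C V_le by (intro enn2real_leI) auto
  have E_ge: "C' * real n powr (- (r / k)) \<le> E"
    using enn2real_mono[OF V_ge fin] C by (simp add: E_def)
  have root: "(D * real n powr (- (r / q))) powr (1/r) = D powr (1/r) * real n powr (-1/q)"
    if "D > 0" for D q :: real
    using that r n by (simp add: powr_mult powr_powr)
  have "E powr (1/r) \<le> (C * real n powr (- (r / l))) powr (1/r)"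
    using E_le r by (intro powr_mono2) (auto simp: E_def)
  then show "quant_e M r n \<le> C powr (1/r) * real n powr (-1/l)"
    using root[OF C(1)] by (simp add: quant_e_def E_def)
  have "(C' * real n powr (- (r / k))) powr (1/r) \<le> E powr (1/r)"
    using E_ge r C by (intro powr_mono2) auto
  then show "C' powr (1/r) * real n powr (-1/k) \<le> quant_e M r n"
    using root[OF C(2)] by (simp add: quant_e_def E_def)
qed

theorem theorem4:
  fixes N :: nat and f :: "nat \<Rightarrow> 'a::euclidean_space \<Rightarrow> 'a"
    and p s c :: "nat \<Rightarrow> real" and M :: "'a measure" and K :: "'a set"
    and r k l :: real
  assumes N2: "N \<ge> 2"
    and p_pos: "\<forall>i<N. p i > 0" and p_sum: "(\<Sum>i<N. p i) = 1"
    and sc: "\<forall>i<N. 0 < s i \<and> s i \<le> c i \<and> c i < 1"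
    and bilip: "\<forall>i<N. \<forall>x y. s i * norm (x - y) \<le> norm (f i x - f i y)
                         \<and> norm (f i x - f i y) \<le> c i * norm (x - y)"
    and M_borel: "sets M = sets borel" and M_prob: "prob_space M"
    and M_inv: "\<forall>A \<in> sets borel. emeasure M A = (\<Sum>i<N. ennreal (p i) * emeasure M (f i -` A))"
    and K_attr: "compact K" "K \<noteq> {}" "K = (\<Union>i<N. f i ` K)"
    and sosc: "SOSC N f K"
    and r_pos: "r > 0"
    and k_pos: "k > 0" and k_eq: "(\<Sum>i<N. (p i * s i powr r) powr (k / (r + k))) = 1"
    and l_pos: "l > 0" and l_eq: "(\<Sum>i<N. (p i * c i powr r) powr (l / (r + l))) = 1"
  shows "ereal k \<le> lower_qdim M r \<and> lower_qdim M r \<le> upper_qdim M r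
         \<and> upper_qdim M r \<le> ereal l"
proof -
  interpret weighted_ifs N f p s c M K
    by (rule weighted_ifs.intro) (use assms in \<open>auto simp: dist_norm\<close>)
  obtain C where C: "C > 0" "\<And>x. x \<ge> 1 \<Longrightarrow> \<exists>B. finite B \<and> B \<noteq> {} \<and> real (card B) \<le> x \<and>
    (\<integral>\<^sup>+y. ennreal (infdist y B powr r) \<partial>M) \<le> ennreal (C * x powr (- (r / l)))"
    using quantizer_exists[OF r_pos l_pos l_eq] by blast
  \<comment> \<open>The lower estimate is available for \<open>k'\<close> strictly below
    \<open>k\<close>. The upper bound is carried along because the positivity of the errors,
    \<open>e_pos\<close>, comes from that estimate.\<close>
  have low: "ereal k' \<le> lower_qdim M r \<and> upper_qdim M r \<le> ereal l" if k': "0 < k'" "k' < k" for k'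
  proof -
    obtain C' where C': "C' > 0" "\<And>B. finite B \<Longrightarrow> B \<noteq> {} \<Longrightarrow>
      ennreal (C' * real (card B) powr (- (r / k'))) \<le> (\<integral>\<^sup>+x. ennreal (infdist x B powr r) \<partial>M)"
      using quantizer_lower[OF sosc r_pos k' k_eq] by blast
    note e = quant_V_bounds_imp_quant_e[OF r_pos C(1) C'(1) _ C(2) C'(2) k'(1)]
    have e_pos: "0 < quant_e M r n" if "n \<ge> 1" for n
      using less_le_trans[OF _ e(2)[of n]] C' that by simp
    \<comment> \<open>The errors tend to 0, hence are eventually below 1 as
      \<open>lower_qdim_ge\<close> requires.\<close>
    have "(\<lambda>n. C powr (1/r) * real n powr (-1/l)) \<longlonglongrightarrow> 0"
      using l_pos by real_asymp
    then have "eventually (\<lambda>n. C powr (1/r) * real n powr (-1/l) < 1) sequentially"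
      by (rule order_tendstoD) simp
    then have "eventually (\<lambda>n. quant_e M r n < 1) sequentially"
      using eventually_ge_at_top[of 1]
    proof eventually_elim
      case (elim n)
      then show ?case using e(1)[of n] by simp
    qed
    then have "ereal k' \<le> lower_qdim M r"
      using e(2) C' k' by (intro lower_qdim_ge[of k' "C' powr (1/r)"]) auto
    moreover have "upper_qdim M r \<le> ereal l"
      using e(1) e_pos C l_pos by (intro upper_qdim_le[of l "C powr (1/r)"]) auto
    ultimately show ?thesis ..
  qed
  have "ereal k \<le> lower_qdim M r"
  proof (rule dense_le)
    fix z assume "z < ereal k"
    \<comment> \<open>The maximum with 0 makes the intermediate \<open>k'\<close> positive.\<close>
    then have "max z 0 < ereal k" using k_pos by simp
    then obtain k' where k': "max z 0 < ereal k'" "ereal k' < ereal k"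
      using ereal_dense2 by blast
    then have "ereal k' \<le> lower_qdim M r" using low[of k'] by simp
    with k' show "z \<le> lower_qdim M r" by (meson less_imp_le max.bounded_iff order_trans)
  qed
  moreover have "lower_qdim M r \<le> upper_qdim M r"
    unfolding lower_qdim_def upper_qdim_def by (rule Liminf_le_Limsup) simp
  moreover have "upper_qdim M r \<le> ereal l" using low[of "k / 2"] k_pos by simp
  ultimately show ?thesis by blast
qed

end
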